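(* Let $(X,\mathcal B,P)$ be a discrete-time Markov process on a topological state space $(X,\mathcal B)$, and suppose that $A\in\mathcal B$ is a compact set such that for any $D\in\mathcal B$ with $D\subseteq A$ the function $x\mapsto P(x,D)$ is continuous on $A$. Then for any set $B\in\mathcal B$ disjoint from $A$ it holds that $m(A\setminus\mathrm{l.a.s.}(A))<\infty$ and, for all $x\in X$, $$w(x;A,B)=w(x;A\setminus\mathrm{l.a.s.}(A),B).$$
   Context: A state space $(X,\mathcal B)$ is topological if $X$ is a Borel subset of a Polish space and $\mathcal B$ is the Borel $\sigma$-algebra of $X$. A discrete-time Markov process is given by a triple $(X,\mathcal B,P)$ with $P$ a stochastic kernel on $(X,\mathcal B)$. Let $(\mathbf x_n)_{n\ge0}$ be the process with kernel $P$, $\mathsf P_x$ its law when $\mathbf x_0=x$, and $\tau_D=\inf\{n\ge0:\mathbf x_n\in D\}$ for $D\in\mathcal B$ (with $\inf\emptyset=\infty$). The infinite-horizon reach-avoid value function is $w(x;A,B)=\mathsf P_x(\tau_B\le\tau_{A^c},\,\tau_B<\infty)$. The invariance value functions are $u_n(x;A)=\mathsf P_x(\tau_{A^c}>n)$, and $m(A)=\inf\{m\ge0:\sup_{x\in X}u_m(x;A)<1\}$ (with $\inf\emptyset=\infty$). A set $D\in\mathcal B$ is absorbing if $P(x,D)=1$ for all $x\in D$; $\mathrm{l.a.s.}(A)$ is the largest absorbing subset of $A$ (it exists for every $A\in\mathcal B$). *)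

theory Defs
  imports "HOL-Probability.Probability"
begin

text \<open>
  The one-step kernels driving a chain started at \<open>x\<close>: the kernel at time 0 is the Dirac mass
  at \<open>x\<close>, the kernel at time \<open>n + 1\<close> is \<open>P\<close> evaluated at the current state \<open>\<omega> n\<close>.
\<close>

fun chain_kernel :: "'a measure \<Rightarrow> ('a \<Rightarrow> 'a measure) \<Rightarrow> 'a \<Rightarrow> nat \<Rightarrow> (nat \<Rightarrow> 'a) \<Rightarrow> 'a measure" where
  "chain_kernel M P x 0 = (\<lambda>\<omega>. return M x)"
| "chain_kernel M P x (Suc n) = (\<lambda>\<omega>. P (\<omega> n))"

text \<open>
  The law of the process on \<open>PiM UNIV (\<lambda>_. M)\<close>, i.e. the projective limit
  (called \<open>PF.lim\<close> inside the locale \<^locale>\<open>Ionescu_Tulcea\<close>) of the finite-dimensional distributions.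
  It is meaningful for a stochastic kernel \<open>P\<close> and \<open>x \<in> space M\<close>; see
  \<open>Ionescu_Tulcea_chain_kernel\<close> below.
\<close>

definition path_law :: "'a measure \<Rightarrow> ('a \<Rightarrow> 'a measure) \<Rightarrow> 'a \<Rightarrow> (nat \<Rightarrow> 'a) measure" where
  "path_law M P x =
    projective_family.lim UNIV (Ionescu_Tulcea.CI (chain_kernel M P x) (\<lambda>_. M)) (\<lambda>_. M)"

definition hitting_time :: "'a set \<Rightarrow> (nat \<Rightarrow> 'a) \<Rightarrow> enat" where
  "hitting_time D \<omega> = Inf {enat n | n. \<omega> n \<in> D}"

definition reach_avoid_value ::
    "'a measure \<Rightarrow> ('a \<Rightarrow> 'a measure) \<Rightarrow> 'a \<Rightarrow> 'a set \<Rightarrow> 'a set \<Rightarrow> real" where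
  "reach_avoid_value M P x A B =
    measure (path_law M P x)
      {\<omega> \<in> space (path_law M P x).
        hitting_time B \<omega> \<le> hitting_time (space M - A) \<omega> \<and> hitting_time B \<omega> < \<infinity>}"

definition invariance_value ::
    "'a measure \<Rightarrow> ('a \<Rightarrow> 'a measure) \<Rightarrow> nat \<Rightarrow> 'a \<Rightarrow> 'a set \<Rightarrow> real" where
  "invariance_value M P n x A =
    measure (path_law M P x)
      {\<omega> \<in> space (path_law M P x). hitting_time (space M - A) \<omega> > enat n}"

text \<open>
  The supremum is taken in \<^typ>\<open>ennreal\<close>, where it is also well behaved on an empty state space.
\<close>

definition contraction_time :: "'a measure \<Rightarrow> ('a \<Rightarrow> 'a measure) \<Rightarrow> 'a set \<Rightarrow> enat" where
  "contraction_time M P A =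
    Inf {enat m | m. (SUP x\<in>space M. ennreal (invariance_value M P m x A)) < 1}"

definition absorbing :: "'a measure \<Rightarrow> ('a \<Rightarrow> 'a measure) \<Rightarrow> 'a set \<Rightarrow> bool" where
  "absorbing M P D \<longleftrightarrow> D \<in> sets M \<and> (\<forall>x\<in>D. measure (P x) D = 1)"

text \<open>
  \<open>Greatest\<close> is with respect to inclusion, so this is the absorbing subset of \<open>A\<close> that contains
  every other absorbing subset of \<open>A\<close>.
\<close>

definition las :: "'a measure \<Rightarrow> ('a \<Rightarrow> 'a measure) \<Rightarrow> 'a set \<Rightarrow> 'a set" where
  "las M P A = (GREATEST D. absorbing M P D \<and> D \<subseteq> A)"

lemma Ionescu_Tulcea_chain_kernel:
  assumes P: "P \<in> M \<rightarrow>\<^sub>M prob_algebra M" and x: "x \<in> space M"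
  shows "Ionescu_Tulcea (chain_kernel M P x) (\<lambda>_. M)"
proof (rule Ionescu_Tulcea.intro)
  have P': "P \<in> M \<rightarrow>\<^sub>M subprob_algebra M"
    using P by (rule measurable_prob_algebraD)
  show "chain_kernel M P x i \<in> PiM {0..<i} (\<lambda>_. M) \<rightarrow>\<^sub>M subprob_algebra M" for i
  proof (cases i)
    case 0
    then show ?thesis using x by (simp add: return_measurable measurable_const space_subprob_algebra
          prob_space_return prob_space_imp_subprob_space)
  next
    case (Suc n)
    then show ?thesis
      using measurable_compose[OF measurable_component_singleton[of n "{0..<i}" "\<lambda>_. M"] P'] by simp
  qed
  show "prob_space (chain_kernel M P x i \<omega>)" if "\<omega> \<in> space (PiM {0..<i} (\<lambda>_. M))" for i \<omega>
  proof (cases i)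
    case 0
    then show ?thesis using x by (simp add: prob_space_return)
  next
    case (Suc n)
    then have "\<omega> n \<in> space M" using that by (auto simp: space_PiM PiE_iff)
    then have "P (\<omega> n) \<in> space (prob_algebra M)" using P by (rule measurable_space[rotated])
    then show ?thesis using Suc by (simp add: space_prob_algebra)
  qed
qed

lemma
  assumes P: "P \<in> M \<rightarrow>\<^sub>M prob_algebra M" and x: "x \<in> space M"
  shows prob_space_path_law: "prob_space (path_law M P x)"
    and sets_path_law: "sets (path_law M P x) = sets (PiM UNIV (\<lambda>_. M))"
    and distr_path_law: "finite J \<Longrightarrow>
      distr (path_law M P x) (PiM J (\<lambda>_. M)) (\<lambda>\<omega>. restrict \<omega> J) =
      Ionescu_Tulcea.CI (chain_kernel M P x) (\<lambda>_. M) J"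
proof -
  interpret Ionescu_Tulcea "chain_kernel M P x" "\<lambda>_. M"
    by (rule Ionescu_Tulcea_chain_kernel[OF P x])
  have *: "path_law M P x = PF.lim" by (simp add: path_law_def)
  show "sets (path_law M P x) = sets (PiM UNIV (\<lambda>_. M))" unfolding * by simp
  show "finite J \<Longrightarrow> distr (path_law M P x) (PiM J (\<lambda>_. M)) (\<lambda>\<omega>. restrict \<omega> J) = CI J"
    unfolding * by (rule distr_lim)
  show "prob_space (path_law M P x)"
  proof
    have "emeasure PF.lim (PF.emb UNIV {} {\<lambda>_. undefined}) = emeasure (CI {}) {\<lambda>_. undefined}"
      by (rule lim) (auto simp: sets_PiM_empty)
    moreover have "PF.emb UNIV {} {\<lambda>_. undefined} = space PF.lim"
      by (auto simp: prod_emb_def PF.space_lim space_PiM PiE_iff)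
    moreover have "space (CI {}) = {\<lambda>_. undefined}"
      by (simp add: CI_def space_PiM_empty)
    ultimately show "emeasure (path_law M P x) (space (path_law M P x)) = 1"
      unfolding * using prob_space.emeasure_space_1[OF PF.prob_space_P[of "{}"]] by simp
  qed
qed

end

theory Submission
  imports Defs
begin

text \<open>
  Let \<open>L = las M P A\<close> and \<open>C = A - L\<close>. A path entering \<open>L\<close> almost surely never leaves it, so it
  misses \<open>B\<close>; hence removing \<open>L\<close> from \<open>A\<close> changes the reach-avoid event by a null set only.
  For the contraction time, let \<open>v n x\<close> be the probability that the next \<open>n\<close> states lie in \<open>C\<close>. The
  sets \<open>{x \<in> A. v n x = 1}\<close> are compact and decreasing in \<open>n\<close>. If their intersection \<open>F\<close> were
  nonempty, then \<open>P x (C \<inter> F) = 1\<close> for \<open>x \<in> F\<close>, so \<open>C \<inter> F\<close> would be a nonempty absorbing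
  subset of \<open>A\<close> disjoint from \<open>L\<close>. Hence \<open>v n < 1\<close> on \<open>A\<close> for some \<open>n\<close>, and the supremum is
  below 1 since the continuous \<open>v n\<close> attains its maximum on \<open>A\<close>.
\<close>

section \<open>Hitting times as conditions on the coordinates of a path\<close>

lemma less_hitting_time_iff: "enat n < hitting_time D \<omega> \<longleftrightarrow> (\<forall>k\<le>n. \<omega> k \<notin> D)"
proof -
  have "hitting_time D \<omega> \<le> enat n \<longleftrightarrow> (\<exists>k\<le>n. \<omega> k \<in> D)"
  proof
    let ?S = "{enat n | n. \<omega> n \<in> D}"
    assume le: "hitting_time D \<omega> \<le> enat n"
    have "?S \<noteq> {}"
    proof
      assume "?S = {}"
      then have "hitting_time D \<omega> = \<infinity>"
        unfolding hitting_time_def by (simp only: Inf_enat_def) simp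
      with le show False by simp
    qed
    then obtain s where "s \<in> ?S" by blast
    then have "hitting_time D \<omega> \<in> ?S" unfolding hitting_time_def by (rule wellorder_InfI)
    with le show "\<exists>k\<le>n. \<omega> k \<in> D" by auto
  next
    assume "\<exists>k\<le>n. \<omega> k \<in> D"
    then obtain k where k: "k \<le> n" "\<omega> k \<in> D" by blast
    then have "hitting_time D \<omega> \<le> enat k"
      unfolding hitting_time_def by (intro wellorder_Inf_le1) blast
    also have "\<dots> \<le> enat n" using k by simp
    finally show "hitting_time D \<omega> \<le> enat n" .
  qed
  then show ?thesis unfolding not_le[symmetric] by blast
qed

text \<open>Rewriting the event by countably many coordinate conditions makes it visibly measurable.
  The bound \<open>k < n\<close> is strict because ties count: in the final application
  \<open>B\<close> lies in the complement \<open>D\<close> of \<open>A\<close>, so the state that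
  reaches \<open>B\<close> also hits \<open>D\<close>.\<close>

lemma hitting_time_le_iff:
  "hitting_time B \<omega> \<le> hitting_time D \<omega> \<and> hitting_time B \<omega> < \<infinity> \<longleftrightarrow>
    (\<exists>n. \<omega> n \<in> B \<and> (\<forall>k<n. \<omega> k \<notin> D))"
proof
  assume *: "hitting_time B \<omega> \<le> hitting_time D \<omega> \<and> hitting_time B \<omega> < \<infinity>"
  then obtain n where n: "hitting_time B \<omega> = enat n" by auto
  obtain m where m: "m \<le> n" "\<omega> m \<in> B" using less_hitting_time_iff[of n B \<omega>] n by auto
  have avoid: "\<omega> k \<notin> B \<and> \<omega> k \<notin> D" if "k < n" for k
  proof -
    have B: "enat k < hitting_time B \<omega>" using that n by simp
    then have "enat k < hitting_time D \<omega>" using * by (blast intro: order.strict_trans2)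
    with B show ?thesis by (simp add: less_hitting_time_iff)
  qed
  with m have "m = n" by (meson order.not_eq_order_implies_strict)
  with m avoid show "\<exists>n. \<omega> n \<in> B \<and> (\<forall>k<n. \<omega> k \<notin> D)" by blast
next
  assume "\<exists>n. \<omega> n \<in> B \<and> (\<forall>k<n. \<omega> k \<notin> D)"
  then obtain n where n: "\<omega> n \<in> B" "\<forall>k<n. \<omega> k \<notin> D" by blast
  then have le: "hitting_time B \<omega> \<le> enat n"
    using less_hitting_time_iff[of n B \<omega>] by (auto simp: not_less)
  have "enat n \<le> hitting_time D \<omega>"
  proof (cases n)
    case (Suc m)
    with n show ?thesis by (simp add: Suc_ile_eq less_hitting_time_iff)
  qed (simp add: zero_enat_def[symmetric])
  with le have "hitting_time B \<omega> \<le> hitting_time D \<omega>" by (rule order.trans)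
  moreover have "hitting_time B \<omega> < \<infinity>" using le by (rule order.strict_trans1) simp
  ultimately show "hitting_time B \<omega> \<le> hitting_time D \<omega> \<and> hitting_time B \<omega> < \<infinity>" ..
qed

section \<open>Integration against the law of the chain\<close>

locale markov_chain =
  fixes M :: "'a measure" and P :: "'a \<Rightarrow> 'a measure"
  assumes kernel[measurable]: "P \<in> M \<rightarrow>\<^sub>M prob_algebra M"
begin

lemma kernel_subprob[measurable]: "P \<in> M \<rightarrow>\<^sub>M subprob_algebra M"
  using kernel by (rule measurable_prob_algebraD)

lemma prob_space_kernel: "x \<in> space M \<Longrightarrow> prob_space (P x)"
  using measurable_space[OF kernel] by (simp add: space_prob_algebra)

lemma sets_kernel: "x \<in> space M \<Longrightarrow> sets (P x) = sets M"
  using measurable_space[OF kernel] by (simp add: space_prob_algebra)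

lemma space_kernel: "x \<in> space M \<Longrightarrow> space (P x) = space M"
  by (rule sets_eq_imp_space_eq[OF sets_kernel])

text \<open>The projective limit has no recursion of its own. A functional of the first m
  coordinates is therefore transferred to the m-step kernel \<open>C 0 m\<close>, which is built one
  coordinate at a time.\<close>

lemma nn_integral_path_law:
  assumes x: "x \<in> space M" and F[measurable]: "F \<in> borel_measurable (PiM {0..<m} (\<lambda>_. M))"
  shows "(\<integral>\<^sup>+\<omega>. F (restrict \<omega> {0..<m}) \<partial>path_law M P x) =
    (\<integral>\<^sup>+\<omega>. F \<omega> \<partial>Ionescu_Tulcea.C (chain_kernel M P x) (\<lambda>_. M) 0 m (\<lambda>_. undefined))"
proof -
  interpret Ionescu_Tulcea "chain_kernel M P x" "\<lambda>_. M"
    by (rule Ionescu_Tulcea_chain_kernel[OF kernel x])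
  \<comment> \<open>\<open>CI J\<close> runs \<open>C\<close> up to the first index beyond
    \<open>J\<close> and then restricts to \<open>J\<close>. For an initial segment of length m that
    index is m, and the restriction is the identity on the extensional functions in the
    space.\<close>
  have u: "up_to {0..<m} = m"
    by (intro antisym) (simp_all add: up_to_iff_Ico, use up_to[of "{0..<m}"] in auto)
  have "(\<lambda>_. undefined) \<in> space (PiM {0..<0::nat} (\<lambda>_. M))" by (simp add: space_PiM)
  from sets_C[OF this, of m] have sets: "sets (C 0 m (\<lambda>_. undefined)) = sets (PiM {0..<m} (\<lambda>_. M))"
    by simp
  have restrict: "(\<lambda>\<omega>. restrict \<omega> {0..<m}) \<in> PiM J (\<lambda>_. M) \<rightarrow>\<^sub>M PiM {0..<m} (\<lambda>_. M)"
    if "{0..<m} \<subseteq> J" for J by (rule measurable_restrict_subset[OF that])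
  have "(\<integral>\<^sup>+\<omega>. F (restrict \<omega> {0..<m}) \<partial>path_law M P x) =
    (\<integral>\<^sup>+\<omega>. F \<omega> \<partial>distr (path_law M P x) (PiM {0..<m} (\<lambda>_. M)) (\<lambda>\<omega>. restrict \<omega> {0..<m}))"
    by (rule nn_integral_distr[symmetric])
      (simp_all only: measurable_cong_sets[OF sets_path_law[OF kernel x] refl]
        measurable_cong_sets[OF sets_distr refl] restrict subset_UNIV F)
  also have "\<dots> = (\<integral>\<^sup>+\<omega>. F \<omega> \<partial>CI {0..<m})"
    by (simp only: distr_path_law[OF kernel x] finite_atLeastLessThan)
  also have "\<dots> = (\<integral>\<^sup>+\<omega>. F (restrict \<omega> {0..<m}) \<partial>C 0 m (\<lambda>_. undefined))"
    unfolding CI_def u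
    by (rule nn_integral_distr)
      (simp_all only: measurable_cong_sets[OF sets refl]
        measurable_cong_sets[OF sets_distr refl] restrict order_refl F)
  also have "\<dots> = (\<integral>\<^sup>+\<omega>. F \<omega> \<partial>C 0 m (\<lambda>_. undefined))"
    by (rule nn_integral_cong)
      (simp add: sets_eq_imp_space_eq[OF sets] space_PiM PiE_iff extensional_restrict)
  finally show ?thesis .
qed

lemma nn_integral_path_law_0:
  assumes x: "x \<in> space M" and f[measurable]: "f \<in> borel_measurable M"
  shows "(\<integral>\<^sup>+\<omega>. f (\<omega> 0) \<partial>path_law M P x) = f x"
proof -
  interpret Ionescu_Tulcea "chain_kernel M P x" "\<lambda>_. M"
    by (rule Ionescu_Tulcea_chain_kernel[OF kernel x])
  have [simp]: "(\<lambda>_. undefined) \<in> space (PiM {0..<0::nat} (\<lambda>_. M))" by (simp add: space_PiM)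
  have "(\<integral>\<^sup>+\<omega>. f (\<omega> 0) \<partial>path_law M P x) = (\<integral>\<^sup>+\<omega>. f (restrict \<omega> {0..<Suc 0} 0) \<partial>path_law M P x)"
    by simp
  also have "\<dots> = (\<integral>\<^sup>+\<omega>. f (\<omega> 0) \<partial>C 0 (Suc 0) (\<lambda>_. undefined))"
    by (rule nn_integral_path_law[OF x]) auto
  also have "\<dots> = (\<integral>\<^sup>+\<omega>. f (\<omega> 0) \<partial>eP 0 (\<lambda>_. undefined))"
    unfolding C.simps add_0 by (subst bind_return[OF measurable_eP]) simp_all
  also have "\<dots> = f x"
    by (subst nn_integral_eP) (auto simp: nn_integral_return x)
  finally show ?thesis .
qed

text \<open>The path up to time n + 1 arises from the path up to time n by appending a coordinate
  drawn from \<open>P (\<omega> n)\<close>. This gives the Markov property: the last state is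
  integrated out, while \<open>g\<close> carries the whole history.\<close>

lemma nn_integral_path_law_Suc:
  assumes x: "x \<in> space M" and g[measurable]: "g \<in> borel_measurable (PiM {0..<Suc n} (\<lambda>_. M))"
    and f[measurable]: "f \<in> borel_measurable M"
  shows "(\<integral>\<^sup>+\<omega>. g (restrict \<omega> {0..<Suc n}) * f (\<omega> (Suc n)) \<partial>path_law M P x) =
    (\<integral>\<^sup>+\<omega>. g (restrict \<omega> {0..<Suc n}) * (\<integral>\<^sup>+y. f y \<partial>P (\<omega> n)) \<partial>path_law M P x)"
proof -
  interpret Ionescu_Tulcea "chain_kernel M P x" "\<lambda>_. M"
    by (rule Ionescu_Tulcea_chain_kernel[OF kernel x])
  have u[simp]: "(\<lambda>_. undefined) \<in> space (PiM {0..<0::nat} (\<lambda>_. M))" by (simp add: space_PiM)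
  let ?J = "{0..<Suc n}" and ?K = "{0..<Suc (Suc n)}"
  let ?F = "\<lambda>\<omega>. g (restrict \<omega> ?J) * f (\<omega> (Suc n))"
  have r: "(\<lambda>\<omega>. restrict \<omega> ?J) \<in> PiM ?K (\<lambda>_. M) \<rightarrow>\<^sub>M PiM ?J (\<lambda>_. M)"
    by (rule measurable_restrict_subset) auto
  have F[measurable]: "?F \<in> borel_measurable (PiM ?K (\<lambda>_. M))"
    using measurable_compose[OF r g] by auto
  have [measurable]: "(\<lambda>x. \<integral>\<^sup>+y. f y \<partial>P x) \<in> borel_measurable M"
    by (rule measurable_compose[OF kernel_subprob nn_integral_measurable_subprob_algebra[OF f]])
  have "(\<integral>\<^sup>+\<omega>. ?F \<omega> \<partial>path_law M P x) = (\<integral>\<^sup>+\<omega>. ?F (restrict \<omega> ?K) \<partial>path_law M P x)"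
    by (intro nn_integral_cong) (simp add: Int_absorb1)
  also have "\<dots> = (\<integral>\<^sup>+\<omega>. ?F \<omega> \<partial>C 0 (Suc (Suc n)) (\<lambda>_. undefined))"
    by (rule nn_integral_path_law[OF x F])
  also have "\<dots> = (\<integral>\<^sup>+\<omega>. (\<integral>\<^sup>+\<omega>'. ?F \<omega>' \<partial>eP (Suc n) \<omega>) \<partial>C 0 (Suc n) (\<lambda>_. undefined))"
    unfolding C.simps(2)[of 0 "Suc n"] add_0
    by (rule nn_integral_bind[OF F])
      (use measurable_eP[of "Suc n"] in \<open>simp add: measurable_cong_sets[OF sets_C refl] del: C.simps\<close>)
  also have "\<dots> = (\<integral>\<^sup>+\<omega>. g \<omega> * (\<integral>\<^sup>+y. f y \<partial>P (\<omega> n)) \<partial>C 0 (Suc n) (\<lambda>_. undefined))"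
  proof (rule nn_integral_cong)
    fix \<omega> assume "\<omega> \<in> space (C 0 (Suc n) (\<lambda>_. undefined))"
    then have \<omega>: "\<omega> \<in> space (PiM ?J (\<lambda>_. M))" by (simp add: space_C del: C.simps)
    then have \<omega>n: "\<omega> n \<in> space M" by (auto simp: space_PiM PiE_iff)
    \<comment> \<open>Appending coordinate \<open>Suc n\<close> leaves the earlier ones alone, so
      the history factor is constant in the inner integral.\<close>
    have e: "restrict (fun_upd \<omega> (Suc n) y) ?J = \<omega>" for y
      using \<omega> by (auto simp: space_PiM PiE_iff restrict_def extensional_def fun_eq_iff)
    have "(\<integral>\<^sup>+\<omega>'. ?F \<omega>' \<partial>eP (Suc n) \<omega>) = (\<integral>\<^sup>+y. g \<omega> * f y \<partial>P (\<omega> n))"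
      by (subst nn_integral_eP[OF \<omega> F]) (simp only: e fun_upd_same chain_kernel.simps)
    also have "\<dots> = g \<omega> * (\<integral>\<^sup>+y. f y \<partial>P (\<omega> n))"
      by (rule nn_integral_cmult) (simp add: measurable_cong_sets[OF sets_kernel[OF \<omega>n] refl])
    finally show "(\<integral>\<^sup>+\<omega>'. ?F \<omega>' \<partial>eP (Suc n) \<omega>) = g \<omega> * (\<integral>\<^sup>+y. f y \<partial>P (\<omega> n))" .
  qed
  also have "\<dots> = (\<integral>\<^sup>+\<omega>. g (restrict \<omega> ?J) * (\<integral>\<^sup>+y. f y \<partial>P (restrict \<omega> ?J n)) \<partial>path_law M P x)"
    by (rule nn_integral_path_law[OF x, symmetric])
      measurable
  finally show ?thesis by simp
qed

section \<open>Probabilities of staying in a set\<close>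

text \<open>The probability that the next \<open>n\<close> states all lie in \<open>C\<close>; the starting state \<open>x\<close> itself is not
  required to, which is what makes this function continuous on all of \<open>A\<close>.\<close>

fun stay_value :: "'a set \<Rightarrow> nat \<Rightarrow> 'a \<Rightarrow> real" where
  "stay_value C 0 x = 1"
| "stay_value C (Suc n) x = (\<integral>y. indicator C y * stay_value C n y \<partial>P x)"

lemma measurable_stay_value[measurable]:
  assumes [measurable]: "C \<in> sets M"
  shows "stay_value C n \<in> borel_measurable M"
proof (induction n)
  case (Suc n)
  note Suc[measurable]
  have "(\<lambda>x. \<integral>y. indicator C y * stay_value C n y \<partial>P x) \<in> borel_measurable M"
    by (rule measurable_compose[OF kernel_subprob integral_measurable_subprob_algebra]) auto
  then show ?case by (simp add: fun_eq_iff cong: measurable_cong)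
qed (simp add: fun_eq_iff cong: measurable_cong)

lemma
  assumes C[measurable]: "C \<in> sets M" and x: "x \<in> space M"
  shows stay_value_nonneg: "0 \<le> stay_value C n x" (is ?nonneg)
    and stay_value_le_1: "stay_value C n x \<le> 1" (is ?le_1)
    and integrable_stay_value: "integrable (P x) (\<lambda>y. indicator C y * stay_value C n y)" (is ?integrable)
proof -
  \<comment> \<open>Integrability at stage n is made conditional on the bounds at stage n, so that
    the induction proving those bounds can already use it.\<close>
  have *: "integrable (P x) (\<lambda>y. indicator C y * stay_value C n y)"
    if "x \<in> space M" "\<And>y. y \<in> space M \<Longrightarrow> 0 \<le> stay_value C n y \<and> stay_value C n y \<le> 1" for x n
  proof -
    interpret prob_space "P x" by (rule prob_space_kernel[OF that(1)])
    note [measurable_cong] = sets_kernel[OF that(1)]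
    show ?thesis
      by (rule integrable_const_bound[where B=1]) (use that in \<open>auto simp: space_kernel indicator_def\<close>)
  qed
  have bnd: "0 \<le> stay_value C n x \<and> stay_value C n x \<le> 1" if "x \<in> space M" for x
    using that
  proof (induction n arbitrary: x)
    case (Suc n)
    interpret prob_space "P x" by (rule prob_space_kernel[OF Suc.prems])
    have "0 \<le> (\<integral>y. indicator C y * stay_value C n y \<partial>P x)"
      by (rule integral_nonneg_AE) (use Suc in \<open>auto simp: space_kernel indicator_def\<close>)
    moreover have "(\<integral>y. indicator C y * stay_value C n y \<partial>P x) \<le> 1"
      by (rule integral_le_const[OF *]) (use Suc in \<open>auto simp: space_kernel indicator_def\<close>)
    ultimately show ?case by simp
  qed simp
  show ?nonneg ?le_1 using bnd[OF x] by auto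
  show ?integrable using *[OF x bnd] by auto
qed

lemma stay_value_Suc_le:
  assumes C: "C \<in> sets M" and "x \<in> space M"
  shows "stay_value C (Suc n) x \<le> stay_value C n x"
  using \<open>x \<in> space M\<close>
proof (induction n arbitrary: x)
  case 0
  then show ?case using stay_value_le_1[OF C, of x "Suc 0"] by (simp del: stay_value.simps(2))
next
  case (Suc n)
  have "(\<integral>y. indicator C y * stay_value C (Suc n) y \<partial>P x) \<le> (\<integral>y. indicator C y * stay_value C n y \<partial>P x)"
    by (rule integral_mono[OF integrable_stay_value[OF C Suc.prems] integrable_stay_value[OF C Suc.prems]])
      (use Suc in \<open>auto simp: space_kernel indicator_def simp del: stay_value.simps\<close>)
  then show ?case by (simp only: stay_value.simps(2)[of C])
qed

text \<open>An integrand bounded by 1 whose mean under a probability measure is 1 equals 1 almost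
  surely, and a product of two factors in [0, 1] is 1 only if both are.\<close>

lemma stay_value_Suc_eq_1D:
  assumes C[measurable]: "C \<in> sets M" and x: "x \<in> space M" and eq: "stay_value C (Suc n) x = 1"
  shows "AE y in P x. y \<in> C \<and> stay_value C n y = 1"
proof -
  interpret prob_space "P x" by (rule prob_space_kernel[OF x])
  let ?f = "\<lambda>y. indicator C y * stay_value C n y"
  have f: "0 \<le> 1 - ?f y" if "y \<in> space M" for y
    using stay_value_nonneg[OF C that, of n] stay_value_le_1[OF C that, of n] by (auto simp: indicator_def)
  have "(\<integral>y. 1 - ?f y \<partial>P x) = 0"
    using eq integrable_stay_value[OF C x, of n] by (simp add: prob_space)
  then have "AE y in P x. 1 - ?f y = 0"
    using integrable_stay_value[OF C x, of n] f
    by (subst (asm) integral_nonneg_eq_0_iff_AE) (auto simp: space_kernel[OF x])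
  then show ?thesis
  proof eventually_elim
    case (elim y)
    then show ?case by (cases "y \<in> C") auto
  qed
qed

lemma nn_integral_stay_value:
  assumes C[measurable]: "C \<in> sets M" and x: "x \<in> space M"
  shows "(\<integral>\<^sup>+y. indicator C y * ennreal (stay_value C n y) \<partial>P x) = ennreal (stay_value C (Suc n) x)"
proof -
  have "(\<integral>\<^sup>+y. indicator C y * ennreal (stay_value C n y) \<partial>P x) =
      (\<integral>\<^sup>+y. ennreal (indicator C y * stay_value C n y) \<partial>P x)"
    by (intro nn_integral_cong) (simp add: indicator_def)
  also have "\<dots> = ennreal (\<integral>y. indicator C y * stay_value C n y \<partial>P x)"
    by (rule nn_integral_eq_integral[OF integrable_stay_value[OF C x]])
      (use x in \<open>auto simp: space_kernel stay_value_nonneg[OF C] indicator_def\<close>)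
  finally show ?thesis by simp
qed

text \<open>From the state at time n, the chain stays in \<open>C\<close> for m more steps with
  probability \<open>stay_value C m\<close>. So only n + m matters: each induction step integrates
  out the last state and raises m by one, which is why m is arbitrary. The case m = 0 gives the
  probability of staying up to time n.\<close>

lemma nn_integral_stay_value_path_law:
  assumes C[measurable]: "C \<in> sets M" and x: "x \<in> space M"
  shows "(\<integral>\<^sup>+\<omega>. indicator {\<omega>. \<forall>k\<le>n. \<omega> k \<in> C} \<omega> * ennreal (stay_value C m (\<omega> n)) \<partial>path_law M P x) =
    indicator C x * ennreal (stay_value C (n + m) x)"
proof (induction n arbitrary: m)
  case 0
  have "(\<integral>\<^sup>+\<omega>. indicator {\<omega>. \<forall>k\<le>0. \<omega> k \<in> C} \<omega> * ennreal (stay_value C m (\<omega> 0)) \<partial>path_law M P x) =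
    (\<integral>\<^sup>+\<omega>. indicator C (\<omega> 0) * ennreal (stay_value C m (\<omega> 0)) \<partial>path_law M P x)"
    by (intro nn_integral_cong) (simp add: indicator_def)
  also have "\<dots> = indicator C x * ennreal (stay_value C m x)"
    by (rule nn_integral_path_law_0[OF x]) measurable
  finally show ?case by simp
next
  case (Suc n)
  let ?J = "{0..<Suc n}"
  \<comment> \<open>Written as a product over coordinates, the indicator of the history is
    measurable factor by factor.\<close>
  define g :: "(nat \<Rightarrow> 'a) \<Rightarrow> ennreal" where "g \<omega> = (\<Prod>k\<in>?J. indicator C (\<omega> k))" for \<omega>
  have [measurable]: "g \<in> borel_measurable (PiM ?J (\<lambda>_. M))"
    unfolding g_def by measurable
  have g: "g (restrict \<omega> ?J) = indicator {\<omega>. \<forall>k\<le>n. \<omega> k \<in> C} \<omega>" for \<omega>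
  proof (cases "\<forall>k\<le>n. \<omega> k \<in> C")
    case False
    then obtain k where "k \<le> n" "\<omega> k \<notin> C" by auto
    then have "g (restrict \<omega> ?J) = 0"
      unfolding g_def by (intro prod_zero) (auto intro!: bexI[of _ k])
    with False show ?thesis by (simp add: indicator_def)
  qed (simp add: g_def indicator_def)
  have "(\<integral>\<^sup>+\<omega>. indicator {\<omega>. \<forall>k\<le>Suc n. \<omega> k \<in> C} \<omega> * ennreal (stay_value C m (\<omega> (Suc n))) \<partial>path_law M P x) =
    (\<integral>\<^sup>+\<omega>. g (restrict \<omega> ?J) * (indicator C (\<omega> (Suc n)) * ennreal (stay_value C m (\<omega> (Suc n)))) \<partial>path_law M P x)"
    unfolding g by (intro nn_integral_cong) (auto simp: indicator_def le_Suc_eq)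
  also have "\<dots> = (\<integral>\<^sup>+\<omega>. g (restrict \<omega> ?J) *
      (\<integral>\<^sup>+y. indicator C y * ennreal (stay_value C m y) \<partial>P (\<omega> n)) \<partial>path_law M P x)"
    by (rule nn_integral_path_law_Suc[OF x]) measurable
  also have "\<dots> = (\<integral>\<^sup>+\<omega>. indicator {\<omega>. \<forall>k\<le>n. \<omega> k \<in> C} \<omega> * ennreal (stay_value C (Suc m) (\<omega> n)) \<partial>path_law M P x)"
  proof (rule nn_integral_cong)
    fix \<omega> assume "\<omega> \<in> space (path_law M P x)"
    then have "\<omega> n \<in> space M"
      using sets_eq_imp_space_eq[OF sets_path_law[OF kernel x]] by (auto simp: space_PiM)
    then show "g (restrict \<omega> ?J) * (\<integral>\<^sup>+y. indicator C y * ennreal (stay_value C m y) \<partial>P (\<omega> n)) =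
        indicator {\<omega>. \<forall>k\<le>n. \<omega> k \<in> C} \<omega> * ennreal (stay_value C (Suc m) (\<omega> n))"
      by (simp only: g nn_integral_stay_value[OF C])
  qed
  also have "\<dots> = indicator C x * ennreal (stay_value C (n + Suc m) x)"
    by (rule Suc)
  finally show ?case by simp
qed

lemma space_path_law: "x \<in> space M \<Longrightarrow> space (path_law M P x) = UNIV \<rightarrow> space M"
  using sets_eq_imp_space_eq[OF sets_path_law[OF kernel]] by (auto simp: space_PiM)

text \<open>The factor \<open>indicator C x\<close> accounts for time 0, which the invariance event
  constrains and \<open>stay_value\<close> ignores.\<close>

lemma invariance_value_eq_stay_value:
  assumes C[measurable]: "C \<in> sets M" and x: "x \<in> space M"
  shows "invariance_value M P n x C = indicator C x * stay_value C n x"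
proof -
  interpret prob_space "path_law M P x" by (rule prob_space_path_law[OF kernel x])
  note [measurable_cong] = sets_path_law[OF kernel x]
  let ?E = "{\<omega> \<in> space (path_law M P x). \<forall>k\<le>n. \<omega> k \<in> C}"
  have E: "?E \<in> sets (path_law M P x)" by measurable
  have eq: "{\<omega> \<in> space (path_law M P x). hitting_time (space M - C) \<omega> > enat n} = ?E"
    by (auto simp: less_hitting_time_iff space_path_law[OF x] Pi_iff)
  have "emeasure (path_law M P x) ?E =
    (\<integral>\<^sup>+\<omega>. indicator {\<omega>. \<forall>k\<le>n. \<omega> k \<in> C} \<omega> * ennreal (stay_value C 0 (\<omega> n)) \<partial>path_law M P x)"
    unfolding nn_integral_indicator[OF E, symmetric]
    by (intro nn_integral_cong) (auto simp: indicator_def)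
  also have "\<dots> = indicator C x * ennreal (stay_value C n x)"
    by (simp only: nn_integral_stay_value_path_law[OF C x] add_0_right)
  also have "\<dots> = ennreal (indicator C x * stay_value C n x)"
    by (simp add: indicator_def)
  finally show ?thesis
    unfolding invariance_value_def eq measure_def
    by (simp add: stay_value_nonneg[OF C x])
qed

section \<open>Absorbing sets\<close>

text \<open>By the Markov property, the probability of being in \<open>L\<close> at time k and
  outside at time k + 1 is an integral of \<open>P (\<omega> k)\<close> of the complement over the
  event that \<omega> k lies in \<open>L\<close>, hence 0. Only countably many k occur.\<close>

lemma AE_path_law_absorbing:
  assumes L: "absorbing M P L" and x: "x \<in> space M"
  shows "AE \<omega> in path_law M P x. \<forall>k. \<omega> k \<in> L \<longrightarrow> \<omega> (Suc k) \<in> L"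
proof -
  have L'[measurable]: "L \<in> sets M" using L by (simp add: absorbing_def)
  note [measurable_cong] = sets_path_law[OF kernel x]
  have "AE \<omega> in path_law M P x. \<omega> k \<in> L \<longrightarrow> \<omega> (Suc k) \<in> L" for k
  proof -
    let ?J = "{0..<Suc k}"
    let ?f = "indicator (space M - L) :: 'a \<Rightarrow> ennreal"
    have "(\<integral>\<^sup>+\<omega>. indicator L (\<omega> k) * ?f (\<omega> (Suc k)) \<partial>path_law M P x) =
      (\<integral>\<^sup>+\<omega>. indicator L (restrict \<omega> ?J k) * ?f (\<omega> (Suc k)) \<partial>path_law M P x)" by simp
    also have "\<dots> = (\<integral>\<^sup>+\<omega>. indicator L (restrict \<omega> ?J k) * (\<integral>\<^sup>+y. ?f y \<partial>P (\<omega> k)) \<partial>path_law M P x)"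
      by (rule nn_integral_path_law_Suc[OF x]) measurable
    also have "\<dots> = (\<integral>\<^sup>+\<omega>. 0 \<partial>path_law M P x)"
    proof (rule nn_integral_cong)
      fix \<omega> assume "\<omega> \<in> space (path_law M P x)"
      then have k: "\<omega> k \<in> space M" by (auto simp: space_path_law[OF x])
      interpret prob_space "P (\<omega> k)" by (rule prob_space_kernel[OF k])
      show "indicator L (restrict \<omega> ?J k) * (\<integral>\<^sup>+y. ?f y \<partial>P (\<omega> k)) = 0"
      proof (cases "\<omega> k \<in> L")
        case True
        have "measure (P (\<omega> k)) (space (P (\<omega> k)) - L) = 0"
          using L True by (subst prob_compl) (auto simp: absorbing_def sets_kernel[OF k])
        then have "emeasure (P (\<omega> k)) (space M - L) = 0"
          by (simp add: emeasure_eq_measure space_kernel[OF k])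
        then show ?thesis by (simp add: sets_kernel[OF k])
      qed simp
    qed
    finally have "(\<integral>\<^sup>+\<omega>. indicator L (\<omega> k) * ?f (\<omega> (Suc k)) \<partial>path_law M P x) = 0" by simp
    then have "AE \<omega> in path_law M P x. indicator L (\<omega> k) * ?f (\<omega> (Suc k)) = 0"
      by (subst (asm) nn_integral_0_iff_AE) auto
    \<comment> \<open>The indicator of \<open>space M - L\<close> vanishes outside
      \<open>space M\<close> too; only inside the space does its vanishing put the state in
      \<open>L\<close>.\<close>
    moreover have "AE \<omega> in path_law M P x. \<omega> (Suc k) \<in> space M"
      by (rule AE_I2) (auto simp: space_path_law[OF x])
    ultimately show ?thesis by eventually_elim (auto simp: indicator_def split: if_splits)
  qed
  then show ?thesis by (simp add: AE_all_countable)
qed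

lemma reach_avoid_value_diff_absorbing:
  assumes L: "absorbing M P L" and A[measurable]: "A \<in> sets M" and B[measurable]: "B \<in> sets M"
    and "L \<inter> B = {}" and x: "x \<in> space M"
  shows "reach_avoid_value M P x A B = reach_avoid_value M P x (A - L) B"
proof -
  interpret prob_space "path_law M P x" by (rule prob_space_path_law[OF kernel x])
  note [measurable_cong] = sets_path_law[OF kernel x]
  have [measurable]: "L \<in> sets M" using L by (simp add: absorbing_def)
  let ?E = "\<lambda>A. {\<omega> \<in> space (path_law M P x). \<exists>n. \<omega> n \<in> B \<and> (\<forall>k<n. \<omega> k \<in> A)}"
  have eq: "reach_avoid_value M P x A B = measure (path_law M P x) (?E A)" for A
    unfolding reach_avoid_value_def hitting_time_le_iff
    by (rule arg_cong[where f="measure _"]) (auto simp: space_path_law[OF x] Pi_iff)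
  have "AE \<omega> in path_law M P x. \<omega> \<in> ?E A \<longleftrightarrow> \<omega> \<in> ?E (A - L)"
    using AE_path_law_absorbing[OF L x]
  proof eventually_elim
    case (elim \<omega>)
    \<comment> \<open>A visit to \<open>L\<close> before time n would keep the path in
      \<open>L\<close> at time n, contradicting its arrival in \<open>B\<close>. So the time
      witnessing one event witnesses the other.\<close>
    have "\<omega> n \<in> L" if "\<omega> k \<in> L" "k \<le> n" for k n
      using that(2,1) by (induction rule: dec_induct) (use elim in auto)
    with \<open>L \<inter> B = {}\<close> show ?case by (blast dest: less_imp_le)
  qed
  then show ?thesis unfolding eq by (rule measure_eq_AE) measurable
qed

text \<open>Iterating \<open>D \<mapsto> {x \<in> D. P x D = 1}\<close> from \<open>A\<close> shows that the largest absorbing subset exists,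
  so that the \<open>GREATEST\<close> in its definition is not a junk value.\<close>

lemma
  assumes A: "A \<in> sets M"
  shows absorbing_las: "absorbing M P (las M P A)"
    and las_subset: "las M P A \<subseteq> A"
    and absorbing_subset_las: "absorbing M P D \<Longrightarrow> D \<subseteq> A \<Longrightarrow> D \<subseteq> las M P A"
proof -
  define l where "l = rec_nat A (\<lambda>_ D. {x \<in> D. measure (P x) D = 1})"
  have l_0: "l 0 = A" and l_Suc: "l (Suc n) = {x \<in> l n. measure (P x) (l n) = 1}" for n
    by (simp_all add: l_def)
  have l[measurable]: "l n \<in> sets M" for n
  proof (induction n)
    case (Suc n)
    note [measurable] = Suc
    have "l (Suc n) = {x \<in> space M. x \<in> l n \<and> measure (P x) (l n) = 1}"
      using sets.sets_into_space[OF Suc] by (auto simp: l_Suc)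
    also have "\<dots> \<in> sets M" by measurable
    finally show ?case .
  qed (simp add: l_0 A)
  define L where "L = (\<Inter>n. l n)"
  have L: "absorbing M P L"
    unfolding absorbing_def
  proof (intro conjI ballI)
    show "L \<in> sets M" unfolding L_def by measurable
    fix x assume "x \<in> L"
    then have xl: "x \<in> l n" for n by (auto simp: L_def)
    then have x: "x \<in> space M" using sets.sets_into_space[OF l] by blast
    interpret prob_space "P x" by (rule prob_space_kernel[OF x])
    \<comment> \<open>Why countably many iterations suffice: a point of \<open>l (Suc n)\<close>
      jumps into \<open>l n\<close> almost surely, and countably many almost sure events hold
      jointly.\<close>
    have "AE y in P x. y \<in> l n" for n
      using xl[of "Suc n"] by (subst prob_eq_1[symmetric]) (auto simp: l_Suc sets_kernel[OF x])
    then have "AE y in P x. y \<in> L" by (simp add: L_def AE_all_countable)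
    then show "measure (P x) L = 1"
      by (subst prob_eq_1) (auto simp: L_def sets_kernel[OF x])
  qed
  have sub: "D \<subseteq> L" if D: "absorbing M P D" "D \<subseteq> A" for D
  proof -
    have "D \<subseteq> l n" for n
    proof (induction n)
      case (Suc n)
      show ?case
      proof
        fix x assume "x \<in> D"
        with D sets.sets_into_space[OF A] have x: "x \<in> space M" by blast
        interpret prob_space "P x" by (rule prob_space_kernel[OF x])
        \<comment> \<open>An absorbing subset survives each iteration: \<open>P x\<close> already
          gives full mass to \<open>D\<close>, which is inside \<open>l n\<close>.\<close>
        have "1 \<le> measure (P x) (l n)"
          using finite_measure_mono[OF Suc] D(1) \<open>x \<in> D\<close> by (auto simp: absorbing_def sets_kernel[OF x])
        with Suc \<open>x \<in> D\<close> show "x \<in> l (Suc n)" by (auto simp: l_Suc intro: antisym)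
      qed
    qed (simp add: l_0 D)
    then show ?thesis by (auto simp: L_def)
  qed
  have "L \<subseteq> A" using l_0 by (auto simp: L_def)
  have "las M P A = L"
    unfolding las_def by (rule Greatest_equality) (use L sub \<open>L \<subseteq> A\<close> in auto)
  then show "absorbing M P (las M P A)" "las M P A \<subseteq> A"
    "absorbing M P D \<Longrightarrow> D \<subseteq> A \<Longrightarrow> D \<subseteq> las M P A"
    using L sub \<open>L \<subseteq> A\<close> by auto
qed

end

section \<open>Continuity and compactness on \<open>A\<close>\<close>

locale strong_feller_chain_on = markov_chain M P
  for M :: "'a::t2_space measure" and P :: "'a \<Rightarrow> 'a measure" +
  fixes A :: "'a set"
  assumes A[measurable]: "A \<in> sets M" and compact_A: "compact A"
    and continuous_on_measure:
      "\<And>D. D \<in> sets M \<Longrightarrow> D \<subseteq> A \<Longrightarrow> continuous_on A (\<lambda>x. measure (P x) D)"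
begin

lemma A_subset_space: "x \<in> A \<Longrightarrow> x \<in> space M"
  using sets.sets_into_space[OF A] by blast

text \<open>The average of the indicators of \<open>{y \<in> A. f y \<ge> j / n}\<close>, \<open>1 \<le> j \<le> n\<close>, rounds \<open>f\<close> down to a
  multiple of \<open>1 / n\<close>, so the integral is a uniform limit of averages of continuous functions.\<close>

lemma continuous_on_integral:
  fixes f :: "'a \<Rightarrow> real"
  assumes f[measurable]: "f \<in> borel_measurable M"
    and bnd: "\<And>y. y \<in> space M \<Longrightarrow> 0 \<le> f y \<and> f y \<le> 1" and supp: "\<And>y. y \<in> space M - A \<Longrightarrow> f y = 0"
  shows "continuous_on A (\<lambda>x. \<integral>y. f y \<partial>P x)"
proof -
  define D where "D n j = {y \<in> A. real j \<le> real n * f y}" for n j :: nat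
  have D[measurable]: "D n j \<in> sets M" for n j
  proof -
    have "D n j = {y \<in> space M. y \<in> A \<and> real j \<le> real n * f y}"
      using A_subset_space by (auto simp: D_def)
    then show ?thesis by simp
  qed
  define h where "h n y = (\<Sum>j\<in>{1..n}. indicator (D n j) y) / real n" for n and y :: 'a
  have h_eq: "h n y = of_int \<lfloor>real n * f y\<rfloor> / real n" if y: "y \<in> space M" for n y
  proof -
    define r where "r = real n * f y"
    define k where "k = nat \<lfloor>r\<rfloor>"
    have "0 \<le> r" and "r \<le> real n"
      using bnd[OF y] by (simp_all add: r_def mult_left_le)
    have le_k: "j \<le> k \<longleftrightarrow> real j \<le> r" for j
      using \<open>0 \<le> r\<close> by (simp only: k_def le_nat_iff zero_le_floor le_floor_iff of_int_of_nat_eq)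
    have "k \<le> n"
      using le_k[of k] \<open>r \<le> real n\<close> by linarith
    have "(\<Sum>j\<in>{1..n}. indicator (D n j) y) = (\<Sum>j\<in>{1..n}. if y \<in> D n j then 1 else 0 :: real)"
      by (intro sum.cong) (auto simp: indicator_def)
    also have "\<dots> = (\<Sum>j\<in>{j \<in> {1..n}. y \<in> D n j}. 1)"
      by (rule sum.inter_filter[symmetric]) simp
    also have "\<dots> = real (card {j \<in> {1..n}. y \<in> D n j})"
      by simp
    \<comment> \<open>Levels start at 1 because \<open>D n 0\<close> is all of \<open>A\<close> and
      would add a spurious 1. Off \<open>A\<close> the function vanishes, so no level is counted on
      either side.\<close>
    also have "{j \<in> {1..n}. y \<in> D n j} = {1..k}"
    proof (cases "y \<in> A")
      case True
      then have "y \<in> D n j \<longleftrightarrow> j \<le> k" for j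
        unfolding le_k unfolding D_def r_def by blast
      then have "{j \<in> {1..n}. y \<in> D n j} = {j. 1 \<le> j \<and> j \<le> n \<and> j \<le> k}"
        by (simp only: atLeastAtMost_iff conj_assoc)
      also have "\<dots> = {1..k}"
        unfolding atLeastAtMost_def atLeast_def atMost_def using \<open>k \<le> n\<close> by (blast intro: order.trans)
      finally show ?thesis .
    next
      case False
      then have "r = 0" using supp[of y] y by (simp add: r_def)
      then have "{1..k} = {}" by (simp add: k_def)
      moreover have "y \<notin> D n j" for j using False unfolding D_def by blast
      ultimately show ?thesis by blast
    qed
    also have "real (card {1..k}) = of_int \<lfloor>r\<rfloor>" using \<open>0 \<le> r\<close> by (simp add: k_def)
    finally show ?thesis by (simp add: h_def r_def)
  qed
  have h_close: "\<bar>h n y - f y\<bar> \<le> 1 / real n" if "y \<in> space M" "0 < n" for n y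
  proof -
    let ?r = "real n * f y"
    have "h n y - f y = (of_int \<lfloor>?r\<rfloor> - ?r) / real n"
      using that by (simp add: h_eq diff_divide_distrib)
    then have "\<bar>h n y - f y\<bar> = \<bar>of_int \<lfloor>?r\<rfloor> - ?r\<bar> / real n"
      by (simp only: abs_divide abs_of_nat)
    also have "\<dots> \<le> 1 / real n"
      by (rule divide_right_mono) (linarith, simp)
    finally show ?thesis .
  qed
  have int_D: "integrable (P x) (indicator (D n j) :: 'a \<Rightarrow> real)" if "x \<in> A" for x n j
  proof -
    have x: "x \<in> space M" by (rule A_subset_space[OF that])
    interpret prob_space "P x" by (rule prob_space_kernel[OF x])
    show ?thesis by (rule integrable_real_indicator) (auto simp: sets_kernel[OF x] emeasure_eq_measure)
  qed
  have int_h: "(\<integral>y. h n y \<partial>P x) = (\<Sum>j\<in>{1..n}. measure (P x) (D n j)) / real n"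
    and integrable_h: "integrable (P x) (h n)" if "x \<in> A" for x n
    using int_D[OF that] sets.sets_into_space[OF D]
    by (simp_all add: h_def[abs_def] space_kernel[OF A_subset_space[OF that]] Int_absorb2)
  have integrable_f: "integrable (P x) f" if "x \<in> A" for x
  proof -
    have x: "x \<in> space M" by (rule A_subset_space[OF that])
    interpret prob_space "P x" by (rule prob_space_kernel[OF x])
    have "f \<in> borel_measurable (P x)"
      using f by (simp only: measurable_cong_sets[OF sets_kernel[OF x] refl])
    then show ?thesis
      by (intro integrable_const_bound[where B=1] AE_I2) (use bnd in \<open>auto simp: space_kernel[OF x]\<close>)
  qed
  \<comment> \<open>The rounding error is at most 1 / n at every state and \<open>P x\<close> has
    total mass 1, so the error of the integral has a bound independent of x.\<close>
  have close: "\<bar>(\<integral>y. h n y \<partial>P x) - (\<integral>y. f y \<partial>P x)\<bar> \<le> 1 / real n" if "x \<in> A" "0 < n" for x n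
  proof -
    have x: "x \<in> space M" by (rule A_subset_space[OF that(1)])
    interpret prob_space "P x" by (rule prob_space_kernel[OF x])
    have "\<bar>\<integral>y. h n y - f y \<partial>P x\<bar> \<le> (\<integral>y. \<bar>h n y - f y\<bar> \<partial>P x)"
      by (rule integral_abs_bound)
    also have "\<dots> \<le> 1 / real n"
      using integrable_h[OF that(1)] integrable_f[OF that(1)] h_close[OF _ that(2)]
      by (intro integral_le_const) (auto simp: space_kernel[OF x])
    finally show ?thesis
      using integrable_h[OF that(1)] integrable_f[OF that(1)] by simp
  qed
  have ulim: "uniform_limit A (\<lambda>n x. \<integral>y. h n y \<partial>P x) (\<lambda>x. \<integral>y. f y \<partial>P x) sequentially"
  proof (rule uniform_limitI)
    fix e :: real assume "0 < e"
    then have "eventually (\<lambda>n. 1 / real n < e) sequentially"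
      by (rule order_tendstoD(2)[OF lim_1_over_n])
    with eventually_gt_at_top[of 0]
    show "\<forall>\<^sub>F n in sequentially. \<forall>x\<in>A. dist (\<integral>y. h n y \<partial>P x) (\<integral>y. f y \<partial>P x) < e"
    proof eventually_elim
      case (elim n)
      show ?case
      proof
        fix x assume "x \<in> A"
        from close[OF this elim(1)] elim(2)
        show "dist (\<integral>y. h n y \<partial>P x) (\<integral>y. f y \<partial>P x) < e"
          unfolding dist_real_def by (rule order.strict_trans1)
      qed
    qed
  qed
  have "continuous_on A (\<lambda>x. \<integral>y. h n y \<partial>P x)" for n
  proof -
    have "continuous_on A (\<lambda>x. measure (P x) (D n j))" for j
      by (rule continuous_on_measure[OF D]) (simp add: D_def)
    \<comment> \<open>Multiplying by the constant \<open>inverse (real n)\<close> raises no nonzero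
      condition, so n = 0 is covered.\<close>
    then have "continuous_on A (\<lambda>x. (\<Sum>j\<in>{1..n}. measure (P x) (D n j)) * inverse (real n))"
      by (intro continuous_intros)
    then show ?thesis by (rule continuous_on_eq) (simp only: int_h divide_inverse)
  qed
  then have "\<forall>\<^sub>F n in sequentially. continuous_on A (\<lambda>x. \<integral>y. h n y \<partial>P x)"
    by (intro always_eventually allI)
  from this ulim trivial_limit_sequentially show ?thesis by (rule uniform_limit_theorem)
qed

text \<open>One application of the kernel already smooths: the integrand is a bounded measurable
  function vanishing off \<open>A\<close>, and its own continuity never enters. Hence a case
  distinction on n instead of an induction.\<close>

lemma continuous_on_stay_value:
  assumes C[measurable]: "C \<in> sets M" and "C \<subseteq> A"
  shows "continuous_on A (stay_value C n)"
proof (cases n)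
  case 0
  have "stay_value C 0 = (\<lambda>_. 1)" by (rule ext) simp
  then show ?thesis by (simp only: 0 continuous_on_const)
next
  case (Suc n)
  have "continuous_on A (\<lambda>x. \<integral>y. indicator C y * stay_value C n y \<partial>P x)"
    by (rule continuous_on_integral)
      (use \<open>C \<subseteq> A\<close> in \<open>auto simp: indicator_def stay_value_nonneg[OF C] stay_value_le_1[OF C]\<close>)
  moreover have "stay_value C (Suc n) = (\<lambda>x. \<integral>y. indicator C y * stay_value C n y \<partial>P x)"
    by (rule ext) simp
  ultimately show ?thesis by (simp only: Suc)
qed

lemma stay_value_diff_las_bound:
  obtains n c where "c < 1" "\<And>x. x \<in> A \<Longrightarrow> stay_value (A - las M P A) n x \<le> c"
proof -
  define C where "C = A - las M P A"
  have C[measurable]: "C \<in> sets M"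
    using absorbing_las[OF A] by (auto simp: C_def absorbing_def)
  have "C \<subseteq> A" by (auto simp: C_def)
  note cont = continuous_on_stay_value[OF C \<open>C \<subseteq> A\<close>]
  define G where "G n = {x \<in> A. stay_value C n x = 1}" for n
  have dec: "G m \<subseteq> G n" if "n \<le> m" for n m
    using that
  proof (induction rule: dec_induct)
    case (step m)
    have "G (Suc m) \<subseteq> G m"
    proof
      fix x assume "x \<in> G (Suc m)"
      then have x: "x \<in> A" "stay_value C (Suc m) x = 1" by (auto simp only: G_def mem_Collect_eq)
      then have "stay_value C m x = 1"
        using stay_value_Suc_le[OF C, of x m] stay_value_le_1[OF C, of x m] A_subset_space[of x] by linarith
      with x show "x \<in> G m" by (simp add: G_def)
    qed
    with step show ?case by blast
  qed simp
  have "\<exists>n. G n = {}"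
  proof (rule ccontr)
    assume ne: "\<nexists>n. G n = {}"
    have "A \<inter> (\<Inter>n\<in>UNIV. G n) \<noteq> {}"
    proof (rule compact_imp_fip_image[OF compact_A])
      \<comment> \<open>Continuity is known on \<open>A\<close> only; the preimage is closed in the
        whole space because a compact set in a Hausdorff space is closed.\<close>
      show "closed (G n)" for n
        unfolding G_def
        by (rule continuous_closed_preimage_constant[OF cont compact_imp_closed[OF compact_A]])
      fix I :: "nat set" assume "finite I" "I \<subseteq> UNIV"
      then obtain m where "\<forall>i\<in>I. i \<le> m" using finite_nat_set_iff_bounded_le by blast
      then have "G m \<subseteq> A \<inter> (\<Inter>n\<in>I. G n)" using dec by (auto simp: G_def)
      then show "A \<inter> (\<Inter>n\<in>I. G n) \<noteq> {}" using ne by blast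
    qed
    then obtain x where "x \<in> A" and x: "x \<in> G n" for n by blast
    \<comment> \<open>The factor \<open>C\<close> makes \<open>F\<close> disjoint from the largest
      absorbing subset by construction.\<close>
    define F where "F = C \<inter> (\<Inter>n. G n)"
    have F[measurable]: "F \<in> sets M"
    proof -
      have "F = {x \<in> space M. x \<in> C \<and> (\<forall>n. x \<in> A \<and> stay_value C n x = 1)}"
        using A_subset_space by (auto simp: F_def G_def)
      then show ?thesis by simp
    qed
    have F1: "measure (P x) F = 1" if "\<And>n. x \<in> G n" for x
    proof -
      have x: "x \<in> space M" using that[of 0] A_subset_space by (simp add: G_def)
      interpret prob_space "P x" by (rule prob_space_kernel[OF x])
      \<comment> \<open>Index shift: membership in \<open>G (Suc n)\<close> sends the next state
        into \<open>C\<close> with value 1 at n. Taking all n at once puts that state in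
        \<open>F\<close>.\<close>
      have "stay_value C (Suc n) x = 1" for n
        using that[of "Suc n"] by (simp add: G_def)
      then have "AE y in P x. \<forall>n. y \<in> C \<and> stay_value C n y = 1"
        using stay_value_Suc_eq_1D[OF C x] by (simp only: AE_all_countable) blast
      then have "AE y in P x. y \<in> F"
        by eventually_elim (use \<open>C \<subseteq> A\<close> in \<open>auto simp: F_def G_def\<close>)
      then show ?thesis by (subst prob_eq_1) (auto simp: sets_kernel[OF x])
    qed
    then have "absorbing M P F" by (auto simp: absorbing_def F_def[symmetric] F) (auto simp: F_def)
    then have "F \<subseteq> las M P A"
      by (rule absorbing_subset_las[OF A]) (use \<open>C \<subseteq> A\<close> in \<open>auto simp: F_def\<close>)
    \<comment> \<open>Maximality forces \<open>F\<close> to be empty, yet \<open>F1\<close> gives it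
      mass 1 from the point x supplied by compactness.\<close>
    then have "F = {}" by (auto simp: F_def C_def)
    with F1[OF x] show False by simp
  qed
  then obtain n where n: "G n = {}" by blast
  show ?thesis
  proof (cases "A = {}")
    case True
    then show ?thesis by (intro that[of 0]) auto
  next
    case False
    then obtain z where z: "z \<in> A" "\<And>x. x \<in> A \<Longrightarrow> stay_value C n x \<le> stay_value C n z"
      using continuous_attains_sup[OF compact_A False cont] by blast
    have "stay_value C n z < 1"
      using n z(1) stay_value_le_1[OF C A_subset_space[OF z(1)], of n] by (force simp: G_def)
    from this z(2) show ?thesis unfolding C_def by (rule that)
  qed
qed

lemma contraction_time_diff_las: "contraction_time M P (A - las M P A) < \<infinity>"
proof -
  let ?C = "A - las M P A"
  obtain n c where c: "c < 1" "\<And>x. x \<in> A \<Longrightarrow> stay_value ?C n x \<le> c"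
    using stay_value_diff_las_bound by blast
  have C: "?C \<in> sets M" using absorbing_las[OF A] by (auto simp: absorbing_def)
  \<comment> \<open>The maximum with 0 covers the states outside the set, where the invariance value
    is 0 and \<open>c\<close> is not known to be nonnegative.\<close>
  have "(SUP x\<in>space M. ennreal (invariance_value M P n x ?C)) \<le> ennreal (max 0 c)"
    by (rule SUP_least)
      (use c in \<open>auto simp: invariance_value_eq_stay_value[OF C] indicator_def intro!: ennreal_leI max.coboundedI2\<close>)
  also have "\<dots> < 1" using c(1) by (simp add: ennreal_less_one_iff)
  finally have "contraction_time M P ?C \<le> enat n"
    unfolding contraction_time_def by (intro Inf_lower) auto
  then show ?thesis by (rule order.strict_trans1) simp
qed

end

theorem theorem3:
  fixes X A B :: "'a::polish_space set" and M :: "'a measure" and P :: "'a \<Rightarrow> 'a measure"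
  assumes "X \<in> sets borel" and "M = restrict_space borel X"
    and "P \<in> M \<rightarrow>\<^sub>M prob_algebra M"
    and "A \<in> sets M" and "compact A"
    and "\<And>D. D \<in> sets M \<Longrightarrow> D \<subseteq> A \<Longrightarrow> continuous_on A (\<lambda>x. measure (P x) D)"
    and "B \<in> sets M" and "A \<inter> B = {}"
  shows "contraction_time M P (A - las M P A) < \<infinity> \<and>
    (\<forall>x\<in>X. reach_avoid_value M P x A B = reach_avoid_value M P x (A - las M P A) B)"
proof -
  interpret strong_feller_chain_on M P A
    using assms by unfold_locales
  have "las M P A \<inter> B = {}" using las_subset[OF A] \<open>A \<inter> B = {}\<close> by blast
  then show ?thesis
    using contraction_time_diff_las
      reach_avoid_value_diff_absorbing[OF absorbing_las[OF A] A \<open>B \<in> sets M\<close>] assms(2)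
    by (simp add: space_restrict_space)
qed

end
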